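(* Consider a player $i$ in a finite extensive-form game with perfect recall, and for $t\ge1$ let $\lambda_i^{(t)}\in\Delta(\mathcal J_i)$ and $q_j^{(t)}\in\mathcal Q_j$, $j\in\mathcal J_i$, have strictly positive entries. Suppose that the sequences $(\lambda_i^{(t)})_t$ and $(q_j^{(t)})_t$, for all $j\in\mathcal J_i$, are $\kappa$-multiplicative-stable, with $0<\kappa<1/(12\mathfrak D_i)$. Let $q_i^{(t)}\in\mathcal Q_i$ be the strategy defined top-down by $q_i^{(t)}[\varnothing]=1$ and, for $\sigma=(j,a)\in\Sigma_i^*$, $$q_i^{(t)}[\sigma]=\frac{\sum_{j'\preceq j}\lambda_i^{(t)}[j']\,q^{(t)}_{j'}[\sigma]\,q_i^{(t)}[\sigma_{j'}]}{\sum_{j'\preceq j}\lambda^{(t)}_i[j']}.$$ Then the sequence $(q_i^{(t)})_t$ is $(12\kappa\mathfrak D_i)$-multiplicative-stable.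
   Context: A sequence $(z^{(t)})$ of vectors with strictly positive entries is $\kappa$-multiplicative-stable, $\kappa\in(0,1)$, if $(1+\kappa)^{-1}z^{(t-1)}[k]\le z^{(t)}[k]\le(1+\kappa)z^{(t-1)}[k]$ for every coordinate $k$ and all $t\ge2$. $\mathcal J_i$ is the set of information sets of player $i$, $\mathcal A_j$ the action set at $j$. For $j,j'\in\mathcal J_i$, $j\prec j'$ if some path from the root of the game tree to a node of $j'$ passes through a node of $j$ ($j\ne j'$); $j\preceq j'$ if $j=j'$ or $j\prec j'$. $\Sigma_i=\{(j,a):j\in\mathcal J_i,a\in\mathcal A_j\}\cup\{\varnothing\}$, $\Sigma_i^*=\Sigma_i\setminus\{\varnothing\}$. $\sigma_j\in\Sigma_i$ is the last sequence of player $i$ before reaching $j$ ($\varnothing$ if none). $\mathfrak D_i$ is the maximum depth of any $j\in\mathcal J_i$ (number of $j'\preceq j$). $\mathcal Q_i=\{q\in\mathbb R^{\Sigma_i}_{\ge0}: q[\varnothing]=1,\ q[\sigma_j]=\sum_{a\in\mathcal A_j}q[(j,a)]\ \forall j\in\mathcal J_i\}$. With $\Sigma_j=\{(j',a')\in\Sigma_i^*:j\preceq j'\}$, $\mathcal Q_j$ is the set of $q\in\mathbb R_{\ge0}^{\Sigma_j}$ with $\sum_{a\in\mathcal A_j}q[(j,a)]=1$ and $q[\sigma_{j'}]=\sum_{a\in\mathcal A_{j'}}q[(j',a)]$ for all $j'\succ j$. The vector $q_i^{(t)}$ is the fixed point, produced by the paper's closed-form algorithm, of $\phi_i^{(t)}=\sum_j\lambda_i^{(t)}[j]\phi_{j\to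 q_j^{(t)}}$, a convex combination of coarse trigger deviation functions. *)

theory Defs
  imports Complex_Main "HOL-Library.Sublist" "HOL-Library.Disjoint_Sets"
begin

definition simplex :: "'k set \<Rightarrow> ('k \<Rightarrow> real) set" where
  "simplex K = {x. (\<forall>k\<in>K. 0 \<le> x k) \<and> (\<Sum>k\<in>K. x k) = 1}"

text \<open>
  Time starts at \<open>t = 1\<close>. A vector indexed by \<open>K\<close> is a function of which only the values
  on \<open>K\<close> matter.
\<close>

definition mult_stable :: "real \<Rightarrow> 'k set \<Rightarrow> (nat \<Rightarrow> 'k \<Rightarrow> real) \<Rightarrow> bool" where
  "mult_stable \<kappa> K z \<longleftrightarrow>
     0 < \<kappa> \<and> \<kappa> < 1 \<and>
     (\<forall>t\<ge>1. \<forall>k\<in>K. 0 < z t k) \<and>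
     (\<forall>t\<ge>2. \<forall>k\<in>K. inverse (1 + \<kappa>) * z (t - 1) k \<le> z t k \<and>
                     z t k \<le> (1 + \<kappa>) * z (t - 1) k)"

text \<open>
  A node of the game tree is identified with its history, the list of actions leading to it from
  the root \<open>[]\<close>. The owner of a node is \<open>Some p\<close> for a player \<open>p\<close> and \<open>None\<close> for chance (the owner
  of a terminal node is irrelevant). Information sets are sets of nodes.
\<close>

record ('p, 'a) game =
  players :: "'p set"
  nodes :: "'a list set"
  owner :: "'a list \<Rightarrow> 'p option"
  infosets :: "'p \<Rightarrow> 'a list set set"
  chance :: "'a list \<Rightarrow> 'a \<Rightarrow> real"
  utility :: "'p \<Rightarrow> 'a list \<Rightarrow> real"

definition actions :: "('p, 'a) game \<Rightarrow> 'a list \<Rightarrow> 'a set" where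
  "actions G h = {a. h @ [a] \<in> nodes G}"

definition decision_nodes :: "('p, 'a) game \<Rightarrow> 'p option \<Rightarrow> 'a list set" where
  "decision_nodes G w = {h \<in> nodes G. actions G h \<noteq> {} \<and> owner G h = w}"

definition finite_game :: "('p, 'a) game \<Rightarrow> bool" where
  "finite_game G \<longleftrightarrow>
     finite (players G) \<and>
     finite (nodes G) \<and> [] \<in> nodes G \<and> (\<forall>h a. h @ [a] \<in> nodes G \<longrightarrow> h \<in> nodes G) \<and>
     (\<forall>h\<in>nodes G. actions G h \<noteq> {} \<longrightarrow> owner G h \<in> insert None (Some ` players G)) \<and>
     (\<forall>p\<in>players G. partition_on (decision_nodes G (Some p)) (infosets G p)) \<and>
     (\<forall>p\<in>players G. \<forall>j\<in>infosets G p. \<forall>h\<in>j. \<forall>h'\<in>j. actions G h = actions G h') \<and>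
     (\<forall>h\<in>decision_nodes G None. chance G h \<in> simplex (actions G h))"

definition infoset_at :: "('p, 'a) game \<Rightarrow> 'p \<Rightarrow> 'a list \<Rightarrow> 'a list set" where
  "infoset_at G p h = (THE j. j \<in> infosets G p \<and> h \<in> j)"

text \<open>
  The information sets of \<open>p\<close> met strictly before \<open>h\<close>, with the actions taken there, in the order
  of play.
\<close>

definition own_history :: "('p, 'a) game \<Rightarrow> 'p \<Rightarrow> 'a list \<Rightarrow> ('a list set \<times> 'a) list" where
  "own_history G p h =
     [(infoset_at G p (take k h), h ! k). k \<leftarrow> [0..<length h], owner G (take k h) = Some p]"

definition perfect_recall :: "('p, 'a) game \<Rightarrow> bool" where
  "perfect_recall G \<longleftrightarrow>
     (\<forall>p\<in>players G. \<forall>j\<in>infosets G p. \<forall>h\<in>j. \<forall>h'\<in>j. own_history G p h = own_history G p h')"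

definition infoset_actions :: "('p, 'a) game \<Rightarrow> 'a list set \<Rightarrow> 'a set" where
  "infoset_actions G j = (\<Union>h\<in>j. actions G h)"

definition info_less :: "'a list set \<Rightarrow> 'a list set \<Rightarrow> bool" where
  "info_less j j' \<longleftrightarrow> j \<noteq> j' \<and> (\<exists>h'\<in>j'. \<exists>h\<in>j. prefix h h')"

definition info_le :: "'a list set \<Rightarrow> 'a list set \<Rightarrow> bool" where
  "info_le j j' \<longleftrightarrow> j = j' \<or> info_less j j'"

text \<open>The empty sequence is \<open>None\<close>, the sequence \<open>(j, a)\<close> is \<open>Some (j, a)\<close>.\<close>

type_synonym 'a seqn = "('a list set \<times> 'a) option"

definition seqs :: "('p, 'a) game \<Rightarrow> 'p \<Rightarrow> 'a seqn set" where
  "seqs G p = insert None {Some (j, a) | j a. j \<in> infosets G p \<and> a \<in> infoset_actions G j}"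

definition seqs_from :: "('p, 'a) game \<Rightarrow> 'p \<Rightarrow> 'a list set \<Rightarrow> 'a seqn set" where
  "seqs_from G p j = {Some (j', a') | j' a'. Some (j', a') \<in> seqs G p \<and> info_le j j'}"

text \<open>Under perfect recall the value below does not depend on the node chosen in \<open>j\<close>.\<close>

definition parent_seq :: "('p, 'a) game \<Rightarrow> 'p \<Rightarrow> 'a list set \<Rightarrow> 'a seqn" where
  "parent_seq G p j =
     (let s = own_history G p (SOME h. h \<in> j) in if s = [] then None else Some (last s))"

definition max_depth :: "('p, 'a) game \<Rightarrow> 'p \<Rightarrow> nat" where
  "max_depth G p = Max ((\<lambda>j. card {j' \<in> infosets G p. info_le j' j}) ` infosets G p)"

definition strategies :: "('p, 'a) game \<Rightarrow> 'p \<Rightarrow> ('a seqn \<Rightarrow> real) set" where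
  "strategies G p =
     {q. (\<forall>\<sigma>\<in>seqs G p. 0 \<le> q \<sigma>) \<and> q None = 1 \<and>
         (\<forall>j\<in>infosets G p. q (parent_seq G p j) = (\<Sum>a\<in>infoset_actions G j. q (Some (j, a))))}"

definition strategies_from :: "('p, 'a) game \<Rightarrow> 'p \<Rightarrow> 'a list set \<Rightarrow> ('a seqn \<Rightarrow> real) set" where
  "strategies_from G p j =
     {q. (\<forall>\<sigma>\<in>seqs_from G p j. 0 \<le> q \<sigma>) \<and>
         (\<Sum>a\<in>infoset_actions G j. q (Some (j, a))) = 1 \<and>
         (\<forall>j'\<in>infosets G p. info_less j j' \<longrightarrow>
            q (parent_seq G p j') = (\<Sum>a\<in>infoset_actions G j'. q (Some (j', a))))}"

end

(*
  Perfect recall makes the information sets preceding j those listed in the own history of any node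
  of j, so they form a chain whose last element carries the parent sequence of j. Flow conservation
  at j follows from the formula for q at the parent sequence. For stability, one application of the
  formula loses a factor (1 + \<kappa>)^3 (one from lam in the numerator, one from the trigger
  strategies, one from the denominator) on top of the loss at the parent sequences; along a chain of
  length at most D this gives (1 + \<kappa>)^(3 D) \<le> exp (3 \<kappa> D) \<le> 1 + 12 \<kappa> D.
*)

theory Submission imports Defs begin

section \<open>Own histories along a path of the game tree\<close>

lemma own_history_snoc:
  "own_history G p (h @ [a]) =
     own_history G p h @ (if owner G h = Some p then [(infoset_at G p h, a)] else [])"
proof -
  let ?f = "\<lambda>h k. if owner G (take k h) = Some p
    then [(infoset_at G p (take k h), h ! k)] else []"
  have "own_history G p (h @ [a]) =
      concat (map (?f (h @ [a])) [0..<length h]) @ ?f (h @ [a]) (length h)"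
    by (simp add: own_history_def)
  \<comment> \<open>For \<open>k < length h\<close> the appended action changes neither
    \<open>take k\<close> nor the entry at \<open>k\<close>.\<close>
  also have "concat (map (?f (h @ [a])) [0..<length h]) = own_history G p h"
    unfolding own_history_def
    by (intro arg_cong[where f = concat] map_cong) (auto simp: nth_append)
  finally show ?thesis
    by simp
qed

lemma prefix_own_history:
  assumes "prefix g h"
  shows "prefix (own_history G p g) (own_history G p h)"
proof -
  obtain ys where "h = g @ ys"
    using assms by (auto simp: prefix_def)
  moreover have "prefix (own_history G p g) (own_history G p (g @ ys))"
    by (induction ys rule: rev_induct)
      (auto simp: own_history_snoc simp flip: append_assoc)
  ultimately show ?thesis
    by simp
qed

section \<open>Precedence of information sets under perfect recall\<close>

locale recall_player =
  fixes G :: "('p, 'a) game" and i :: 'p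
  assumes finite_game: "finite_game G"
    and perfect_recall: "perfect_recall G"
    and player: "i \<in> players G"
begin

lemma node_snocD: "h @ [a] \<in> nodes G \<Longrightarrow> h \<in> nodes G"
  using finite_game by (auto simp: finite_game_def)

lemma partition_infosets: "partition_on (decision_nodes G (Some i)) (infosets G i)"
  using finite_game player by (auto simp: finite_game_def)

lemma infoset_nodeD:
  assumes "j \<in> infosets G i" "h \<in> j"
  shows "h \<in> nodes G" "owner G h = Some i" "actions G h \<noteq> {}"
proof -
  have "h \<in> decision_nodes G (Some i)"
    using assms partition_onD1[OF partition_infosets] by blast
  then show "h \<in> nodes G" "owner G h = Some i" "actions G h \<noteq> {}"
    by (simp_all add: decision_nodes_def)
qed

lemma infoset_unique:
  assumes "j \<in> infosets G i" "j' \<in> infosets G i" "h \<in> j" "h \<in> j'"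
  shows "j = j'"
  using assms disjointD[OF partition_onD2[OF partition_infosets]] by blast

lemma infoset_nonempty: "j \<in> infosets G i \<Longrightarrow> j \<noteq> {}"
  using partition_onD3[OF partition_infosets] by blast

lemma infoset_at_eq:
  assumes "j \<in> infosets G i" "h \<in> j"
  shows "infoset_at G i h = j"
  unfolding infoset_at_def
  by (rule the_equality) (use assms infoset_unique in \<open>simp, metis\<close>)

lemma own_history_eq:
  assumes "j \<in> infosets G i" "h \<in> j" "h' \<in> j"
  shows "own_history G i h = own_history G i h'"
  using assms perfect_recall player unfolding perfect_recall_def by blast

text \<open>The successor certifies that \<open>h\<close> is not terminal; only for such nodes does
  the owner place \<open>h\<close> in an information set.\<close>

lemma infoset_at_decision:
  assumes "h @ [a] \<in> nodes G" "owner G h = Some i"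
  shows "infoset_at G i h \<in> infosets G i" "h \<in> infoset_at G i h"
    and "a \<in> infoset_actions G (infoset_at G i h)"
proof -
  have a: "a \<in> actions G h"
    using assms by (simp add: actions_def)
  then have "h \<in> decision_nodes G (Some i)"
    using assms node_snocD by (auto simp: decision_nodes_def)
  then obtain j where j: "j \<in> infosets G i" "h \<in> j"
    using partition_onD1[OF partition_infosets] by blast
  with a show "infoset_at G i h \<in> infosets G i" "h \<in> infoset_at G i h"
    and "a \<in> infoset_actions G (infoset_at G i h)"
    by (auto simp: infoset_at_eq infoset_actions_def)
qed

lemma finite_infosets: "finite (infosets G i)"
proof (rule finite_elements[OF _ partition_infosets])
  show "finite (decision_nodes G (Some i))"
    using finite_game by (auto simp: decision_nodes_def finite_game_def)
qed

text \<open>An entry is written when the path leaves a node of the player, and that node is the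
  witness \<open>g\<close>. The last conjunct makes the history of \<open>h\<close> strictly longer
  than that of \<open>g\<close>, which later excludes that \<open>h\<close> and \<open>g\<close>
  share an information set.\<close>

lemma own_history_memD:
  assumes "h \<in> nodes G" "(j, a) \<in> set (own_history G i h)"
  shows "\<exists>g\<in>j. j \<in> infosets G i \<and> prefix g h \<and>
    prefix (own_history G i g @ [(j, a)]) (own_history G i h)"
  using assms
proof (induction h rule: rev_induct)
  case Nil
  then show ?case
    by (simp add: own_history_def)
next
  case (snoc b h)
  show ?case
  proof (cases "(j, a) \<in> set (own_history G i h)")
    case True
    with snoc node_snocD obtain g where g: "g \<in> j" "j \<in> infosets G i" "prefix g h"
      "prefix (own_history G i g @ [(j, a)]) (own_history G i h)"
      by blast
    moreover have "prefix (own_history G i h) (own_history G i (h @ [b]))"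
      by (simp add: prefix_own_history)
    ultimately show ?thesis
      by (meson prefix_order.trans prefix_snoc)
  next
    case False
    then have *: "owner G h = Some i" "j = infoset_at G i h" "a = b"
      using snoc.prems(2) by (auto simp: own_history_snoc split: if_splits)
    with infoset_at_decision[OF snoc.prems(1)] show ?thesis
      by (intro bexI[of _ h]) (auto simp: own_history_snoc)
  qed
qed

text \<open>The witness \<open>g\<close> is the last node of the player strictly before
  \<open>h\<close>; moves of others or of chance after it add nothing to the history.\<close>

lemma own_history_last:
  assumes "h \<in> nodes G" "own_history G i h \<noteq> []"
  shows "\<exists>j a g. j \<in> infosets G i \<and> g \<in> j \<and> a \<in> infoset_actions G j \<and>
    own_history G i h = own_history G i g @ [(j, a)]"
  using assms
proof (induction h rule: rev_induct)
  case Nil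
  then show ?case
    by (simp add: own_history_def)
next
  case (snoc b h)
  show ?case
  proof (cases "owner G h = Some i")
    case True
    then show ?thesis
      using infoset_at_decision[OF snoc.prems(1)] by (auto simp: own_history_snoc)
  next
    case False
    then show ?thesis
      using snoc node_snocD by (auto simp: own_history_snoc)
  qed
qed

text \<open>Precedence asks for some pair of nodes, while own histories agree on all of
  \<open>j'\<close> by perfect recall; so it can be read off the history of any single node
  \<open>h'\<close>.\<close>

lemma info_less_iff:
  assumes "j \<in> infosets G i" "j' \<in> infosets G i" "h' \<in> j'"
  shows "info_less j j' \<longleftrightarrow> j \<in> fst ` set (own_history G i h')"
proof
  assume "info_less j j'"
  then obtain h g where *: "h \<in> j'" "g \<in> j" "prefix g h" "j \<noteq> j'"
    by (auto simp: info_less_def)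
  then have "g \<noteq> h"
    using assms infoset_unique by blast
  \<comment> \<open>The action \<open>a\<close> that leaves \<open>g\<close> towards
    \<open>h\<close> is the one recorded together with \<open>j\<close>.\<close>
  with * obtain a ys where h: "h = (g @ [a]) @ ys"
    by (metis append.assoc append_Cons append_Nil append_Nil2 neq_Nil_conv prefix_def)
  have "own_history G i (g @ [a]) = own_history G i g @ [(j, a)]"
    using assms * infoset_nodeD infoset_at_eq by (simp add: own_history_snoc)
  then have "(j, a) \<in> set (own_history G i h)"
    using prefix_own_history[of "g @ [a]" h G i] h set_mono_prefix by fastforce
  then show "j \<in> fst ` set (own_history G i h')"
    using own_history_eq[OF assms(2) *(1) assms(3)] by force
next
  assume "j \<in> fst ` set (own_history G i h')"
  then obtain a where "(j, a) \<in> set (own_history G i h')"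
    by auto
  then obtain g where g: "g \<in> j" "prefix g h'"
    "prefix (own_history G i g @ [(j, a)]) (own_history G i h')"
    using own_history_memD infoset_nodeD(1) assms by meson
  have "j \<noteq> j'"
  proof
    assume "j = j'"
    then have "own_history G i g = own_history G i h'"
      using own_history_eq assms g by blast
    with prefix_length_le[OF g(3)] show False
      by simp
  qed
  with g assms show "info_less j j'"
    by (auto simp: info_less_def)
qed

lemma parent_seq_eq:
  assumes "j \<in> infosets G i" "h \<in> j"
  shows "parent_seq G i j =
    (if own_history G i h = [] then None else Some (last (own_history G i h)))"
proof -
  have "own_history G i (SOME h. h \<in> j) = own_history G i h"
    using assms by (intro own_history_eq) (auto intro: someI)
  then show ?thesis
    by (simp add: parent_seq_def)
qed

text \<open>The history at \<open>j\<close> is the history at \<open>j0\<close> followed by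
  \<open>(j0, a0)\<close>. Hence the strict predecessors of \<open>j\<close> are exactly the sets at
  or before \<open>j0\<close>, which is the index set in the formula for \<open>q\<close> at the
  parent sequence.\<close>

lemma parent_seq_cases:
  assumes "j \<in> infosets G i"
  obtains (root) "parent_seq G i j = None" "{j' \<in> infosets G i. info_less j' j} = {}"
  | (step) j0 a0 where "parent_seq G i j = Some (j0, a0)" "j0 \<in> infosets G i"
      "a0 \<in> infoset_actions G j0" "info_less j0 j"
      "{j' \<in> infosets G i. info_less j' j} = {j' \<in> infosets G i. info_le j' j0}"
proof -
  obtain h where h: "h \<in> j"
    using infoset_nonempty[OF assms] by auto
  show thesis
  proof (cases "own_history G i h = []")
    case True
    then show thesis
      using root parent_seq_eq[OF assms h] info_less_iff[OF _ assms h] by auto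
  next
    case False
    then obtain j0 a0 g where *: "j0 \<in> infosets G i" "g \<in> j0" "a0 \<in> infoset_actions G j0"
      "own_history G i h = own_history G i g @ [(j0, a0)]"
      using own_history_last[OF infoset_nodeD(1)[OF assms h]] by blast
    have "{j' \<in> infosets G i. info_less j' j} = {j' \<in> infosets G i. info_le j' j0}"
      using info_less_iff[OF _ assms h] info_less_iff[OF _ *(1,2)] *(1,4)
      by (auto simp: info_le_def)
    moreover have "info_less j0 j"
      using info_less_iff[OF _ assms h] * by auto
    ultimately show thesis
      using step[of j0 a0] parent_seq_eq[OF assms h] * by auto
  qed
qed

section \<open>Depth of an information set, the measure for top-down induction\<close>

definition rank :: "'a list set \<Rightarrow> nat" where
  "rank j = card {j' \<in> infosets G i. info_le j' j}"

text \<open>Own histories at \<open>j\<close> are contained in those at \<open>j'\<close>, so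
  predecessors of \<open>j\<close> precede \<open>j'\<close>. The inclusion of down-sets is strict
  because \<open>j'\<close> lies only in its own.\<close>

lemma rank_less:
  assumes "j \<in> infosets G i" "j' \<in> infosets G i" "info_less j j'"
  shows "rank j < rank j'"
proof -
  obtain h where h: "h \<in> j'"
    using infoset_nonempty assms by auto
  then obtain a where "(j, a) \<in> set (own_history G i h)"
    using info_less_iff[OF assms(1,2)] assms(3) by force
  then obtain g where g: "g \<in> j" "prefix (own_history G i g @ [(j, a)]) (own_history G i h)"
    using own_history_memD infoset_nodeD(1) assms h by meson
  then have sub: "set (own_history G i g) \<subseteq> set (own_history G i h)"
    and len: "length (own_history G i g) < length (own_history G i h)"
    using set_mono_prefix prefix_length_le by fastforce+
  have trans: "info_less j'' j'" if "j'' \<in> infosets G i" "info_less j'' j" for j''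
    using that sub info_less_iff[OF _ assms(2) h] info_less_iff[OF _ assms(1) g(1)] by blast
  \<comment> \<open>A cycle would make an information set precede itself.\<close>
  have "\<not> info_less j' j"
  proof
    assume "info_less j' j"
    then have "info_less j j"
      using info_less_iff assms g h sub trans by (metis info_less_def)
    then show False
      by (simp add: info_less_def)
  qed
  then have "j' \<notin> {j'' \<in> infosets G i. info_le j'' j}"
    using assms by (auto simp: info_le_def info_less_def)
  moreover have "j' \<in> {j'' \<in> infosets G i. info_le j'' j'}"
    using assms by (simp add: info_le_def)
  moreover have "{j'' \<in> infosets G i. info_le j'' j} \<subseteq> {j'' \<in> infosets G i. info_le j'' j'}"
    using trans assms by (auto simp: info_le_def)
  ultimately show ?thesis
    unfolding rank_def by (intro psubset_card_mono) (use finite_infosets in auto)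
qed

lemma rank_le: "j \<in> infosets G i \<Longrightarrow> j' \<in> infosets G i \<Longrightarrow> info_le j j' \<Longrightarrow> rank j \<le> rank j'"
  using rank_less by (force simp: info_le_def)

lemma rank_le_max_depth: "j \<in> infosets G i \<Longrightarrow> rank j \<le> max_depth G i"
  using finite_infosets by (auto simp: rank_def max_depth_def)

lemma rank_pos: "j \<in> infosets G i \<Longrightarrow> 0 < rank j"
  using finite_infosets by (auto simp: rank_def card_gt_0_iff info_le_def)

end

section \<open>The closed-form strategy at one fixed time\<close>

locale trigger_fixed_point = recall_player G i
  for G :: "('p, 'a) game" and i :: 'p +
  fixes lam :: "'a list set \<Rightarrow> real" and qtr :: "'a list set \<Rightarrow> 'a seqn \<Rightarrow> real"
    and q :: "'a seqn \<Rightarrow> real"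
  assumes lam_pos: "j \<in> infosets G i \<Longrightarrow> 0 < lam j"
    and qtr_strategy: "j \<in> infosets G i \<Longrightarrow> qtr j \<in> strategies_from G i j"
    and qtr_pos: "j \<in> infosets G i \<Longrightarrow> \<sigma> \<in> seqs_from G i j \<Longrightarrow> 0 < qtr j \<sigma>"
    and q_None: "q None = 1"
    and q_Some: "j \<in> infosets G i \<Longrightarrow> a \<in> infoset_actions G j \<Longrightarrow>
      q (Some (j, a)) =
        (\<Sum>j' | j' \<in> infosets G i \<and> info_le j' j.
            lam j' * qtr j' (Some (j, a)) * q (parent_seq G i j'))
        / (\<Sum>j' | j' \<in> infosets G i \<and> info_le j' j. lam j')"
begin

lemma sum_lam_pos:
  assumes "j \<in> infosets G i"
  shows "0 < (\<Sum>j' | j' \<in> infosets G i \<and> info_le j' j. lam j')"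
  using assms finite_infosets lam_pos by (intro sum_pos) (auto simp: info_le_def)

lemma qtr_pos_Some:
  assumes "j \<in> infosets G i" "j' \<in> infosets G i" "info_le j' j" "a \<in> infoset_actions G j"
  shows "0 < qtr j' (Some (j, a))"
  using assms by (intro qtr_pos) (auto simp: seqs_from_def seqs_def)

text \<open>The formula at \<open>j\<close> only refers to parent sequences of sets at or before
  \<open>j\<close>; these are empty or belong to sets of smaller rank, so induction on the rank
  applies.\<close>

lemma q_pos_Some:
  assumes "j \<in> infosets G i" "a \<in> infoset_actions G j"
  shows "0 < q (Some (j, a))"
  using assms
proof (induction "rank j" arbitrary: j a rule: less_induct)
  case less
  have parent: "0 < q (parent_seq G i j')" if j': "j' \<in> infosets G i" "info_le j' j" for j'
    using j'(1)
  proof (cases rule: parent_seq_cases)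
    case root
    then show ?thesis
      by (simp add: q_None)
  next
    case (step j0 a0)
    then have "rank j0 < rank j"
      using rank_less rank_le less.prems(1) j' by (meson order.strict_trans2)
    with less.hyps step show ?thesis
      by simp
  qed
  have "0 < (\<Sum>j' | j' \<in> infosets G i \<and> info_le j' j.
            lam j' * qtr j' (Some (j, a)) * q (parent_seq G i j'))"
    using less.prems finite_infosets
    by (intro sum_pos) (auto simp: lam_pos qtr_pos_Some parent info_le_def)
  then show ?case
    using less.prems by (simp add: q_Some sum_lam_pos)
qed

lemma q_pos: "\<sigma> \<in> seqs G i \<Longrightarrow> 0 < q \<sigma>"
  by (auto simp: seqs_def q_None q_pos_Some)

text \<open>Sum the formula over the actions at \<open>j\<close>. The trigger strategy started at
  \<open>j\<close> has total mass 1 there, and those started earlier conserve flow into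
  \<open>j\<close>. The numerators then add up to \<open>q\<close> at the parent sequence times the
  full sum of \<open>lam\<close>.\<close>

lemma q_flow:
  assumes j: "j \<in> infosets G i"
  shows "q (parent_seq G i j) = (\<Sum>a\<in>infoset_actions G j. q (Some (j, a)))"
proof -
  let ?U = "{j' \<in> infosets G i. info_le j' j}" and ?P = "{j' \<in> infosets G i. info_less j' j}"
  let ?\<sigma> = "parent_seq G i j"
  have U: "?U = insert j ?P" "j \<notin> ?P" "finite ?P"
    using j finite_infosets by (auto simp: info_le_def info_less_def)
  have own: "(\<Sum>a\<in>infoset_actions G j. qtr j (Some (j, a))) = 1"
    using qtr_strategy[OF j] by (simp add: strategies_from_def)
  have pred: "(\<Sum>a\<in>infoset_actions G j. qtr j' (Some (j, a))) = qtr j' ?\<sigma>" if "j' \<in> ?P" for j'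
    using qtr_strategy[of j'] j that by (simp add: strategies_from_def)
  \<comment> \<open>This is the formula for \<open>q\<close> at the parent sequence with the
    denominator cleared, since \<open>?P\<close> is the down-set of \<open>j0\<close>. At a root
    both sides are 0.\<close>
  have preds: "(\<Sum>j'\<in>?P. lam j' * qtr j' ?\<sigma> * q (parent_seq G i j')) = q ?\<sigma> * sum lam ?P"
    using j
  proof (cases rule: parent_seq_cases)
    case root
    then show ?thesis
      by (simp only: sum.empty mult_zero_right)
  next
    case (step j0 a0)
    show ?thesis
      unfolding step(5) using q_Some[OF step(2,3)] sum_lam_pos[OF step(2)] step(1) by simp
  qed
  have "(\<Sum>a\<in>infoset_actions G j. q (Some (j, a)))
      = (\<Sum>a\<in>infoset_actions G j. \<Sum>j'\<in>?U.
          lam j' * qtr j' (Some (j, a)) * q (parent_seq G i j')) / sum lam ?U"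
    using q_Some[OF j] by (simp add: sum_divide_distrib)
  also have "(\<Sum>a\<in>infoset_actions G j. \<Sum>j'\<in>?U.
          lam j' * qtr j' (Some (j, a)) * q (parent_seq G i j'))
      = (\<Sum>j'\<in>?U. lam j' * (\<Sum>a\<in>infoset_actions G j. qtr j' (Some (j, a)))
          * q (parent_seq G i j'))"
    by (subst sum.swap) (simp add: sum_distrib_left sum_distrib_right)
  also have "\<dots> = lam j * q ?\<sigma> + (\<Sum>j'\<in>?P. lam j' * qtr j' ?\<sigma> * q (parent_seq G i j'))"
    unfolding U(1) using U(2,3) own pred by simp
  also have "\<dots> = q ?\<sigma> * sum lam ?U"
    unfolding preds U(1) using U(2,3) by (simp add: algebra_simps)
  also have "\<dots> / sum lam ?U = q ?\<sigma>"
    using sum_lam_pos[OF j] by simp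
  finally show ?thesis
    by simp
qed

lemma q_strategy: "q \<in> strategies G i"
  using q_pos q_flow q_None by (auto simp: strategies_def less_imp_le)

text \<open>Induction on the rank, at a cost of \<open>c ^ 3\<close> per level. Both bounds on
  \<open>lam\<close> are required because \<open>lam\<close> occurs in numerator and denominator;
  the trigger strategies occur in the numerator only, so one bound on them suffices.\<close>

lemma q_ratio:
  fixes c :: real
  assumes other: "trigger_fixed_point G i lam' qtr' q'"
    and c: "1 \<le> c"
    and lam_le: "\<And>j. j \<in> infosets G i \<Longrightarrow> lam' j \<le> c * lam j"
    and lam_ge: "\<And>j. j \<in> infosets G i \<Longrightarrow> lam j \<le> c * lam' j"
    and qtr_le: "\<And>j \<sigma>. j \<in> infosets G i \<Longrightarrow> \<sigma> \<in> seqs_from G i j \<Longrightarrow> qtr' j \<sigma> \<le> c * qtr j \<sigma>"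
    and "j \<in> infosets G i" "a \<in> infoset_actions G j"
  shows "q' (Some (j, a)) \<le> c ^ (3 * rank j) * q (Some (j, a))"
  using assms(6,7)
proof (induction "rank j" arbitrary: j a rule: less_induct)
  case less
  interpret other: trigger_fixed_point G i lam' qtr' q'
    by (rule other)
  note j = less.prems
  let ?U = "{j' \<in> infosets G i. info_le j' j}"
  let ?N = "\<Sum>j'\<in>?U. lam j' * qtr j' (Some (j, a)) * q (parent_seq G i j')"
  let ?N' = "\<Sum>j'\<in>?U. lam' j' * qtr' j' (Some (j, a)) * q' (parent_seq G i j')"
  \<comment> \<open>A nonempty parent sequence belongs to a set of rank at most
    \<open>rank j - 1\<close>; at the empty sequence both values are 1 and \<open>1 \<le> c\<close>
    suffices.\<close>
  have parent: "0 < q (parent_seq G i j') \<and> 0 < q' (parent_seq G i j') \<and>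
      q' (parent_seq G i j') \<le> c ^ (3 * (rank j - 1)) * q (parent_seq G i j')"
    if j': "j' \<in> ?U" for j'
  proof -
    from j' have "j' \<in> infosets G i"
      by simp
    then show ?thesis
    proof (cases rule: parent_seq_cases)
      case root
      then show ?thesis
        using c by (simp add: q_None other.q_None)
    next
      case (step j0 a0)
      then have lt: "rank j0 < rank j"
        using rank_less rank_le j(1) j' by (metis (mono_tags) mem_Collect_eq order.strict_trans2)
      have "q' (Some (j0, a0)) \<le> c ^ (3 * rank j0) * q (Some (j0, a0))"
        using less.hyps[OF lt step(2,3)] .
      also have "\<dots> \<le> c ^ (3 * (rank j - 1)) * q (Some (j0, a0))"
        using q_pos_Some[OF step(2,3)] c lt by (intro mult_right_mono power_increasing) auto
      finally show ?thesis
        using step q_pos_Some other.q_pos_Some by simp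
    qed
  qed
  \<comment> \<open>Termwise, one factor \<open>c\<close> comes from \<open>lam'\<close>, one from
    \<open>qtr'\<close>, and the power from the parent sequence.\<close>
  have "?N' \<le> (\<Sum>j'\<in>?U. (c * lam j') * (c * qtr j' (Some (j, a)))
        * (c ^ (3 * (rank j - 1)) * q (parent_seq G i j')))"
  proof (intro sum_mono mult_mono)
    fix j' assume j': "j' \<in> ?U"
    then have "Some (j, a) \<in> seqs_from G i j'"
      using j by (auto simp: seqs_from_def seqs_def)
    with j' show "lam' j' \<le> c * lam j'" "qtr' j' (Some (j, a)) \<le> c * qtr j' (Some (j, a))"
      "0 \<le> qtr' j' (Some (j, a))" "0 \<le> c * lam j'" "0 \<le> c * lam j' * (c * qtr j' (Some (j, a)))"
      using lam_le qtr_le lam_pos[of j'] qtr_pos[of j'] other.qtr_pos[of j'] c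
      by (auto simp: less_imp_le)
    show "q' (parent_seq G i j') \<le> c ^ (3 * (rank j - 1)) * q (parent_seq G i j')"
      "0 \<le> q' (parent_seq G i j')"
      using parent[OF j'] by auto
  qed
  also have "\<dots> = c ^ (3 * (rank j - 1) + 2) * ?N"
    by (simp add: sum_distrib_left power_add power2_eq_square mult_ac)
  finally have N: "?N' \<le> c ^ (3 * (rank j - 1) + 2) * ?N" .
  have S: "sum lam ?U \<le> c * sum lam' ?U"
    unfolding sum_distrib_left using lam_ge by (intro sum_mono) auto
  have S0: "0 < sum lam ?U" "0 < sum lam' ?U"
    using sum_lam_pos other.sum_lam_pos j by auto
  have N0: "0 \<le> ?N"
    using lam_pos qtr_pos_Some parent j by (intro sum_nonneg) (simp add: less_imp_le)
  \<comment> \<open>Comparing the quotients in cross-multiplied form; the denominators contribute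
    the third factor \<open>c\<close>.\<close>
  have "?N' * sum lam ?U \<le> (c ^ (3 * (rank j - 1) + 2) * ?N) * (c * sum lam' ?U)"
    using N S S0 N0 c by (intro mult_mono) auto
  also have "\<dots> = c ^ (3 * (rank j - 1) + 3) * ?N * sum lam' ?U"
    by (simp add: power_add power2_eq_square power3_eq_cube)
  \<comment> \<open>The subtraction on naturals is exact because \<open>j\<close> counts itself in
    its rank.\<close>
  also have "3 * (rank j - 1) + 3 = 3 * rank j"
    using rank_pos[OF j(1)] by simp
  finally have "?N' / sum lam' ?U \<le> c ^ (3 * rank j) * (?N / sum lam ?U)"
    using S0 by (simp add: field_simps)
  then show ?case
    using q_Some[OF j] other.q_Some[OF j] by simp
qed

end

section \<open>Numerical estimate and stability over time\<close>

lemma one_plus_power_le: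
  fixes x :: real
  assumes "0 \<le> x" "12 * x * real n < 1"
  shows "(1 + x) ^ (3 * n) \<le> 1 + 12 * x * real n"
proof -
  have "(1 + x) ^ (3 * n) \<le> exp x ^ (3 * n)"
    using assms by (intro power_mono) auto
  also have "\<dots> = exp (3 * x * real n)"
    by (simp add: exp_of_nat_mult[symmetric] mult_ac)
  \<comment> \<open>With \<open>y = 3 * x * real n\<close>, which is below \<open>1/4\<close>, this
    is the bound of \<open>exp y\<close> by \<open>1 + y + y\<^sup>2\<close>; the square is then at
    most \<open>y\<close>.\<close>
  also have "\<dots> \<le> 1 + 3 * x * real n + (3 * x * real n)\<^sup>2"
    using assms by (intro exp_bound) auto
  also have "(3 * x * real n)\<^sup>2 \<le> 3 * x * real n"
    unfolding power2_eq_square using assms by (intro mult_left_le) auto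
  finally have "(1 + x) ^ (3 * n) \<le> 1 + 6 * x * real n"
    by simp
  moreover have "6 * x * real n \<le> 12 * x * real n"
    using assms by (intro mult_right_mono) auto
  ultimately show ?thesis
    by linarith
qed

lemma mult_stable_ratio:
  assumes "mult_stable \<kappa> K z" "2 \<le> t" "k \<in> K"
  shows "z t k \<le> (1 + \<kappa>) * z (t - 1) k" "z (t - 1) k \<le> (1 + \<kappa>) * z t k"
proof -
  have "0 < \<kappa>" "inverse (1 + \<kappa>) * z (t - 1) k \<le> z t k"
    using assms by (auto simp: mult_stable_def)
  then show "z (t - 1) k \<le> (1 + \<kappa>) * z t k"
    by (simp add: field_simps)
qed (use assms in \<open>auto simp: mult_stable_def\<close>)

theorem proposition5p2:
  fixes G :: "('p, 'a) game" and i :: 'p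
    and lam :: "nat \<Rightarrow> 'a list set \<Rightarrow> real"
    and qtr :: "'a list set \<Rightarrow> nat \<Rightarrow> 'a seqn \<Rightarrow> real"
    and q :: "nat \<Rightarrow> 'a seqn \<Rightarrow> real"
    and \<kappa> :: real
  assumes "finite_game G" and "perfect_recall G" and "i \<in> players G"
    and "\<And>t. t \<ge> 1 \<Longrightarrow> lam t \<in> simplex (infosets G i)"
    and "\<And>t j. t \<ge> 1 \<Longrightarrow> j \<in> infosets G i \<Longrightarrow> 0 < lam t j"
    and "\<And>t j. t \<ge> 1 \<Longrightarrow> j \<in> infosets G i \<Longrightarrow> qtr j t \<in> strategies_from G i j"
    and "\<And>t j \<sigma>. t \<ge> 1 \<Longrightarrow> j \<in> infosets G i \<Longrightarrow> \<sigma> \<in> seqs_from G i j \<Longrightarrow> 0 < qtr j t \<sigma>"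
    and "mult_stable \<kappa> (infosets G i) lam"
    and "\<And>j. j \<in> infosets G i \<Longrightarrow> mult_stable \<kappa> (seqs_from G i j) (qtr j)"
    and "0 < \<kappa>" and "\<kappa> < 1 / (12 * real (max_depth G i))"
    and "\<And>t. t \<ge> 1 \<Longrightarrow> q t None = 1"
    and "\<And>t j a. t \<ge> 1 \<Longrightarrow> j \<in> infosets G i \<Longrightarrow> a \<in> infoset_actions G j \<Longrightarrow>
           q t (Some (j, a)) =
             (\<Sum>j' | j' \<in> infosets G i \<and> info_le j' j.
                 lam t j' * qtr j' t (Some (j, a)) * q t (parent_seq G i j'))
             / (\<Sum>j' | j' \<in> infosets G i \<and> info_le j' j. lam t j')"
  shows "(\<forall>t\<ge>1. q t \<in> strategies G i) \<and>
         mult_stable (12 * \<kappa> * real (max_depth G i)) (seqs G i) q"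
proof -
  interpret recall_player G i
    using assms(1-3) by unfold_locales
  let ?D = "max_depth G i"
  let ?K = "12 * \<kappa> * real ?D"
  have fixed: "trigger_fixed_point G i (lam t) (\<lambda>j. qtr j t) (q t)" if "1 \<le> t" for t
    using assms(5-7,12,13) that by unfold_locales auto
  \<comment> \<open>An empty sum cannot equal 1. A positive depth makes \<open>?K\<close> positive
    and allows the bound on \<open>\<kappa>\<close> to be multiplied out.\<close>
  have "infosets G i \<noteq> {}"
    using assms(4)[of 1] by (auto simp: simplex_def)
  then have D: "0 < ?D"
    using rank_pos rank_le_max_depth by (metis all_not_in_conv order.strict_trans2)
  then have K: "0 < ?K" "?K < 1"
    using assms(10,11) by (simp_all add: field_simps)
  \<comment> \<open>Stated for both orders of two consecutive times, since the ratio bound is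
    symmetric in time; it yields the upper and the lower bound of stability.\<close>
  have step: "q s \<sigma> \<le> (1 + ?K) * q t \<sigma>"
    if "2 \<le> m" "s = m \<and> t = m - 1 \<or> s = m - 1 \<and> t = m" and \<sigma>: "\<sigma> \<in> seqs G i" for m s t \<sigma>
  proof -
    have "1 \<le> s" "1 \<le> t"
      using that by auto
    interpret s: trigger_fixed_point G i "lam s" "\<lambda>j. qtr j s" "q s"
      using fixed \<open>1 \<le> s\<close> .
    interpret t: trigger_fixed_point G i "lam t" "\<lambda>j. qtr j t" "q t"
      using fixed \<open>1 \<le> t\<close> .
    show ?thesis
    proof (cases \<sigma>)
      case None
      then show ?thesis
        using K by (simp add: s.q_None t.q_None)
    next
      case (Some x)
      with \<sigma> obtain j a where ja: "\<sigma> = Some (j, a)" "j \<in> infosets G i" "a \<in> infoset_actions G j"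
        by (auto simp: seqs_def)
      have "q s \<sigma> \<le> (1 + \<kappa>) ^ (3 * rank j) * q t \<sigma>"
        unfolding ja(1)
      proof (rule t.q_ratio[OF s.trigger_fixed_point_axioms])
        show "lam s j' \<le> (1 + \<kappa>) * lam t j'" "lam t j' \<le> (1 + \<kappa>) * lam s j'"
          if "j' \<in> infosets G i" for j'
          using mult_stable_ratio[OF assms(8) \<open>2 \<le> m\<close> that] \<open>s = m \<and> t = m - 1 \<or> _\<close> by auto
        show "qtr j' s \<tau> \<le> (1 + \<kappa>) * qtr j' t \<tau>"
          if "j' \<in> infosets G i" "\<tau> \<in> seqs_from G i j'" for j' \<tau>
          using mult_stable_ratio[OF assms(9)[OF that(1)] \<open>2 \<le> m\<close> that(2)]
            \<open>s = m \<and> t = m - 1 \<or> _\<close> by auto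
      qed (use ja assms(10) in auto)
      \<comment> \<open>Passing from the rank of \<open>j\<close> to the maximum depth makes the
        bound uniform over all sequences.\<close>
      also have "\<dots> \<le> (1 + \<kappa>) ^ (3 * ?D) * q t \<sigma>"
        using rank_le_max_depth[OF ja(2)] t.q_pos[OF \<sigma>] assms(10)
        by (intro mult_right_mono power_increasing) auto
      also have "\<dots> \<le> (1 + ?K) * q t \<sigma>"
        using one_plus_power_le[of \<kappa> ?D] K assms(10) t.q_pos[OF \<sigma>]
        by (intro mult_right_mono) auto
      finally show ?thesis .
    qed
  qed
  have lower: "inverse (1 + ?K) * q (t - 1) \<sigma> \<le> q t \<sigma>" if "2 \<le> t" "\<sigma> \<in> seqs G i" for t \<sigma>
  proof -
    have "inverse (1 + ?K) * q (t - 1) \<sigma> \<le> inverse (1 + ?K) * ((1 + ?K) * q t \<sigma>)"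
      using step[OF that(1) _ that(2), of "t - 1" t] K by (intro mult_left_mono) auto
    also have "\<dots> = q t \<sigma>"
      using K by (simp flip: mult.assoc)
    finally show ?thesis .
  qed
  have upper: "q t \<sigma> \<le> (1 + ?K) * q (t - 1) \<sigma>" if "2 \<le> t" "\<sigma> \<in> seqs G i" for t \<sigma>
    using step[OF that(1) _ that(2), of t "t - 1"] by simp
  have pos: "0 < q t \<sigma>" if "1 \<le> t" "\<sigma> \<in> seqs G i" for t \<sigma>
    using trigger_fixed_point.q_pos[OF fixed] that .
  have "mult_stable ?K (seqs G i) q"
    unfolding mult_stable_def by (intro conjI allI ballI impI K lower upper pos)
  moreover have "q t \<in> strategies G i" if "1 \<le> t" for t
    using trigger_fixed_point.q_strategy[OF fixed] that .
  ultimately show ?thesis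
    by simp
qed

end
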